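(* Let $M\in\mathbb{C}^{p\times p}$ be nonsingular, let $\mathcal{A}\in\mathbb{C}^{m\times m\times p}$ have tubal index $k$, and let $\mathcal{B}\in\mathbb{C}^{m\times 1\times p}$. Then $\mathcal{X}=\mathcal{A}^{\mathrm D}*_M\mathcal{B}$ satisfies $\mathcal{A}*_M\mathcal{X}=\mathcal{B}$ if and only if $\mathcal{B}\in\mathscr{R}_M(\mathcal{A}^k)$.
   Context: Transform: for $\mathcal{A}\in\mathbb{C}^{m\times n\times p}$, $\tilde{\mathcal{A}}=\mathcal{A}\times_3 M\in\mathbb{C}^{m\times n\times p}$ is given by $(\tilde{\mathcal{A}})_{ijk}=\sum_{s=1}^p(\mathcal{A})_{ijs}M_{ks}$, and $\tilde{\mathcal{A}}^{(i)}=\tilde{\mathcal{A}}(:,:,i)$ is its $i$th frontal slice. Since $M$ is nonsingular, $\mathcal{A}\mapsto\tilde{\mathcal{A}}$ is a bijection. $M$-product: for $\mathcal{A}\in\mathbb{C}^{m\times n\times p}$, $\mathcal{B}\in\mathbb{C}^{n\times l\times p}$, $\mathcal{A}*_M\mathcal{B}$ is the unique $\mathcal{C}\in\mathbb{C}^{m\times l\times p}$ with $\tilde{\mathcal{C}}^{(i)}=\tilde{\mathcal{A}}^{(i)}\tilde{\mathcal{B}}^{(i)}$, $i=1,\dots,p$. The identity tensor $\mathcal{I}$ has $\tilde{\mathcal{I}}^{(i)}=I_m$ for all $i$; powers are taken with respect to $*_M$, with $\mathcal{A}^0=\mathcal{I}$. Range: $\mathscr{R}_M(\mathcal{A})=\{\mathcal{A}*_M\mathcal{Z}:\mathcal{Z}\in\mathbb{C}^{n\times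 1\times p}\}$ for $\mathcal{A}\in\mathbb{C}^{m\times n\times p}$. Tubal index of $\mathcal{A}\in\mathbb{C}^{m\times m\times p}$: $k=\max_{1\le i\le p}\mathrm{ind}(\tilde{\mathcal{A}}^{(i)})$, where $\mathrm{ind}(A)$ is the least integer $k\ge 0$ with $\mathrm{rank}(A^k)=\mathrm{rank}(A^{k+1})$. Drazin inverse: for $\mathcal{A}$ of tubal index $k$, $\mathcal{A}^{\mathrm D}$ is the unique $\mathcal{X}\in\mathbb{C}^{m\times m\times p}$ with $\mathcal{X}*_M\mathcal{A}*_M\mathcal{X}=\mathcal{X}$, $\mathcal{A}*_M\mathcal{X}=\mathcal{X}*_M\mathcal{A}$ and $\mathcal{X}*_M\mathcal{A}^{k+1}=\mathcal{A}^k$. *)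

theory Defs
  imports "HOL-Analysis.Analysis"
begin

text \<open>
  A tensor in \<open>C^(m x n x p)\<close> has type \<open>complex^'p^'n^'m\<close>, so that \<open>A $ i $ j $ k\<close> is its
  \<open>(i,j,k)\<close> entry. The type variables range over the finite index types, which are nonempty.
\<close>

definition mode3 :: "complex^'p^'p \<Rightarrow> complex^'p^'n^'m \<Rightarrow> complex^'p^'n^'m"
  where "mode3 M A = (\<chi> i j k. \<Sum>s\<in>UNIV. A $ i $ j $ s * M $ k $ s)"

definition frontal_slice :: "complex^'p^'n^'m \<Rightarrow> 'p \<Rightarrow> complex^'n^'m"
  where "frontal_slice A k = (\<chi> i j. A $ i $ j $ k)"

abbreviation tslice :: "complex^'p^'p \<Rightarrow> complex^'p^'n^'m \<Rightarrow> 'p \<Rightarrow> complex^'n^'m"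
  where "tslice M A \<equiv> frontal_slice (mode3 M A)"

definition mprod :: "complex^'p^'p \<Rightarrow> complex^'p^'n^'m \<Rightarrow> complex^'p^'l^'n \<Rightarrow> complex^'p^'l^'m"
  where "mprod M A B = (THE C. \<forall>i. tslice M C i = tslice M A i ** tslice M B i)"

definition mident :: "complex^'p^'p \<Rightarrow> complex^'p^'m^'m"
  where "mident M = (THE C. \<forall>i. tslice M C i = mat 1)"

primrec mpow :: "complex^'p^'p \<Rightarrow> complex^'p^'m^'m \<Rightarrow> nat \<Rightarrow> complex^'p^'m^'m"
  where
    "mpow M A 0 = mident M"
  | "mpow M A (Suc n) = mprod M A (mpow M A n)"

definition mrange :: "complex^'p^'p \<Rightarrow> complex^'p^'n^'m \<Rightarrow> (complex^'p^1^'m) set"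
  where "mrange M A = {mprod M A Z | Z :: complex^'p^1^'n. True}"

text \<open>Multiplication in the library type \<open>complex^'m^'m\<close> is componentwise, hence \<open>(^)\<close> is not the
  matrix power.\<close>

primrec matrix_power :: "complex^'m^'m \<Rightarrow> nat \<Rightarrow> complex^'m^'m"
  where
    "matrix_power A 0 = mat 1"
  | "matrix_power A (Suc n) = A ** matrix_power A n"

definition matrix_index :: "complex^'m^'m \<Rightarrow> nat"
  where "matrix_index A = (LEAST k. rank (matrix_power A k) = rank (matrix_power A (Suc k)))"

definition tubal_index :: "complex^'p^'p \<Rightarrow> complex^'p^'m^'m \<Rightarrow> nat"
  where "tubal_index M A = Max (range (\<lambda>i. matrix_index (tslice M A i)))"

definition drazin :: "complex^'p^'p \<Rightarrow> complex^'p^'m^'m \<Rightarrow> complex^'p^'m^'m"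
  where "drazin M A = (THE X.
      mprod M (mprod M X A) X = X \<and>
      mprod M A X = mprod M X A \<and>
      mprod M X (mpow M A (Suc (tubal_index M A))) = mpow M A (tubal_index M A))"

text \<open>For nonsingular \<open>M\<close> a tensor is determined by its transformed slices, which can be prescribed
  arbitrarily; so the descriptions defining the product and the identity do denote.\<close>

lemma ex1_tslice:
  fixes M :: "complex^'p^'p" and F :: "'p \<Rightarrow> complex^'n^'m"
  assumes "invertible M"
  shows "\<exists>!C. \<forall>i. tslice M C i = F i"
proof -
  obtain N where N: "M ** N = mat 1" "N ** M = mat 1"
    using assms by (auto simp: invertible_def)
  have row: "mode3 M C $ i $ j = M *v (C $ i $ j)" for C :: "complex^'p^'n^'m" and i j
    by (simp add: mode3_def matrix_vector_mult_def vec_eq_iff mult.commute)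
  have iff: "(\<forall>k. tslice M C k = F k) \<longleftrightarrow> (\<forall>i j. M *v (C $ i $ j) = (\<chi> k. F k $ i $ j))"
    for C :: "complex^'p^'n^'m"
    by (auto simp: frontal_slice_def row vec_eq_iff)
  have inv: "M *v x = y \<longleftrightarrow> x = N *v y" for x y
    using N by (metis matrix_vector_mul_assoc matrix_vector_mul_lid)
  have "(\<forall>k. tslice M C k = F k) \<longleftrightarrow> C = (\<chi> i j. N *v (\<chi> k. F k $ i $ j))"
    for C :: "complex^'p^'n^'m"
    unfolding iff inv by (simp add: vec_eq_iff)
  then show ?thesis by auto
qed

lemma tslice_mprod:
  assumes "invertible M"
  shows "tslice M (mprod M A B) i = tslice M A i ** tslice M B i"
  using theI'[OF ex1_tslice[OF assms, of "\<lambda>i. tslice M A i ** tslice M B i"]]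
  by (simp add: mprod_def)

lemma tslice_mident:
  fixes M :: "complex^'p^'p"
  assumes "invertible M"
  shows "tslice M (mident M) i = (mat 1 :: complex^'m^'m)"
  using theI'[OF ex1_tslice[OF assms, of "\<lambda>i. mat 1 :: complex^'m^'m"]]
  by (simp add: mident_def)

end

theory Submission
  imports Defs
begin

text \<open>
  Put \<open>k\<close> for the tubal index and \<open>X\<close> for the Drazin inverse of \<open>A\<close>. Once \<open>X\<close> is known to
  satisfy its three defining equations, the equivalence is short. If \<open>B = A X B\<close>, note that \<open>A X\<close> is
  idempotent and its factors commute, so that \<open>A X = A\<^sup>k X\<^sup>k A X\<close> and \<open>B\<close> lies in the range of
  \<open>A\<^sup>k\<close>. Conversely \<open>A X A\<^sup>k = X A\<^sup>k\<^sup>+\<^sup>1 = A\<^sup>k\<close>, so \<open>A X\<close> fixes everything in that range.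

  The work is in the existence and uniqueness of \<open>X\<close>. Following Drazin, this needs nothing but a
  monoid in which \<open>A\<^sup>k\<close> is both a left and a right multiple of \<open>A\<^sup>k\<^sup>+\<^sup>1\<close>
  (\<open>drazin_exists\<close>, \<open>drazin_unique\<close>). Square tensors form a monoid under the \<open>M\<close>-product, and
  because the transformed slices of a tensor can be prescribed at will, the two divisibilities may
  be checked on every slice. There they follow from the stabilisation of the ranks of the powers
  (\<open>matrix_power_stable_factors\<close>): equal row spaces give the left factor, and then the matrix is
  injective, hence surjective, on the range of its \<open>k\<close>-th power, which gives the right factor.
\<close>

section \<open>Drazin inverses in a monoid\<close>

lemma (in monoid_mult) power_eq_mult_power_Suc_mono:
  assumes "a ^ j = z * a ^ Suc j" and "j \<le> k"
  shows "a ^ k = z * a ^ Suc k"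
proof -
  have "a ^ k = a ^ j * a ^ (k - j)"
    using assms(2) by (simp flip: power_add)
  also have "\<dots> = z * (a ^ Suc j * a ^ (k - j))"
    using assms(1) by (metis mult.assoc)
  also have "a ^ Suc j * a ^ (k - j) = a ^ Suc k"
    using assms(2) by (simp flip: power_add power_Suc)
  finally show ?thesis .
qed

lemma (in monoid_mult) power_eq_power_Suc_mult_mono:
  assumes "a ^ j = a ^ Suc j * y" and "j \<le> k"
  shows "a ^ k = a ^ Suc k * y"
proof -
  have "a ^ k = a ^ (k - j) * a ^ j"
    using assms(2) by (simp flip: power_add)
  also have "\<dots> = (a ^ (k - j) * a ^ Suc j) * y"
    using assms(1) by (metis mult.assoc)
  also have "a ^ (k - j) * a ^ Suc j = a ^ Suc k"
    using assms(2) by (simp flip: power_add power_Suc)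
  finally show ?thesis .
qed

lemma (in monoid_mult) power_eq_power_mult_power_add:
  assumes "a ^ k = z * a ^ Suc k"
  shows "a ^ k = z ^ n * a ^ (k + n)"
proof (induction n)
  case (Suc n)
  have "a ^ (k + n) = z * a ^ Suc (k + n)"
    using power_eq_mult_power_Suc_mono[OF assms] by simp
  then show ?case
    using Suc by (metis add_Suc_right mult.assoc power_Suc2)
qed simp

lemma (in monoid_mult) power_eq_power_add_mult_power:
  assumes "a ^ k = a ^ Suc k * y"
  shows "a ^ k = a ^ (k + n) * y ^ n"
proof (induction n)
  case (Suc n)
  have "a ^ (k + n) = a ^ Suc (k + n) * y"
    using power_eq_power_Suc_mult_mono[OF assms] by simp
  then show ?case
    using Suc by (metis add_Suc_right mult.assoc power_Suc)
qed simp

text \<open>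
  Iterating the hypotheses gives \<open>a\<^sup>k = w g = g v\<close> with \<open>g = a\<^sup>2\<^sup>k\<^sup>+\<^sup>1\<close>. The witness is
  \<open>w a\<^sup>k = w g v = a\<^sup>k v\<close>, which is \<open>a\<^sup>k g\<^sup>- a\<^sup>k\<close> for an inner inverse \<open>g\<^sup>-\<close> of \<open>g\<close> whenever there
  is one. Having it in both forms is what makes it commute with \<open>a\<close>.
\<close>
lemma (in monoid_mult) drazin_exists:
  assumes l: "a ^ k = z * a ^ Suc k" and r: "a ^ k = a ^ Suc k * y"
  shows "\<exists>x. x * a * x = x \<and> a * x = x * a \<and> x * a ^ Suc k = a ^ k"
proof -
  define w where "w = z ^ Suc k"
  define v where "v = y ^ Suc k"
  define g where "g = a ^ (k + Suc k)"
  have wg: "w * g = a ^ k" and gv: "g * v = a ^ k"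
    using power_eq_power_mult_power_add[OF l, of "Suc k"]
      power_eq_power_add_mult_power[OF r, of "Suc k"]
    by (simp_all only: w_def v_def g_def)
  have g: "a ^ k * a ^ Suc k = g" "a ^ Suc k * a ^ k = g" "a * g = g * a"
    unfolding g_def by (metis power_add add.commute power_commutes)+
  have aS: "a ^ Suc k = a * a ^ k" "a ^ Suc k = a ^ k * a"
    by (rule power_Suc, rule power_Suc2)
  define x where "x = w * a ^ k"
  have x2: "x = a ^ k * v"
    unfolding x_def by (metis wg gv mult.assoc)
  have ax: "a * x = a ^ Suc k * v"
    unfolding x2 aS(1) by (simp only: mult.assoc)
  have xa: "x * a = w * a ^ Suc k"
    unfolding x_def aS(2) by (simp only: mult.assoc)
  have "w * a ^ Suc k = w * (a * (g * v))"
    by (simp only: gv aS(1))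
  also have "\<dots> = w * g * a * v"
    using g(3) by (metis mult.assoc)
  also have "\<dots> = a ^ Suc k * v"
    by (simp only: wg aS(2))
  finally have comm: "a * x = x * a"
    by (simp only: ax xa)
  have 3: "x * a ^ Suc k = a ^ k"
    unfolding x_def by (metis g(1) wg mult.assoc)
  have "x * a * x = x * (a ^ Suc k * v)"
    by (simp only: mult.assoc ax)
  also have "\<dots> = x"
    by (metis 3 x2 mult.assoc)
  finally show ?thesis
    using comm 3 by blast
qed

text \<open>
  The product \<open>a x\<close> is idempotent, so it equals its power with exponent \<open>n + 1\<close>, and
  \<open>(a x)\<^sup>n = a\<^sup>n x\<^sup>n\<close>. The trailing \<open>a x\<close> makes the identity true for \<open>n = 0\<close> as well, the
  exponent that belongs to an invertible \<open>a\<close>.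
\<close>
lemma (in monoid_mult) mult_eq_powers_mult:
  assumes "x * a * x = x" and "a * x = x * a"
  shows "a * x = a ^ n * x ^ n * (a * x)"
proof (induction n)
  case (Suc n)
  have "a * x ^ n = x ^ n * a"
    using assms(2) by (metis power_commuting_commutes)
  then have "a ^ Suc n * x ^ Suc n * (a * x) = a ^ n * x ^ n * (a * (x * a * x))"
    by (metis mult.assoc power_Suc2)
  then show ?case
    using assms(1) Suc by metis
qed simp

text \<open>
  Both candidates equal \<open>y a x\<close>. The product \<open>y a\<close> fixes \<open>a\<^sup>k\<close> from the left, hence also \<open>a x\<close>,
  of which \<open>a\<^sup>k\<close> is a left factor; so \<open>x = (a x) x = y a x\<close>. Likewise \<open>a x\<close> fixes \<open>a\<^sup>k\<close> from the
  right, hence also \<open>a y\<close>, of which \<open>a\<^sup>k\<close> is a right factor; so \<open>y = y (a y) = y a x\<close>.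
\<close>
lemma (in monoid_mult) drazin_unique:
  assumes x: "x * a * x = x" "a * x = x * a" "x * a ^ Suc k = a ^ k"
    and y: "y * a * y = y" "a * y = y * a" "y * a ^ Suc k = a ^ k"
  shows "x = y"
proof -
  have "a * x = y * a ^ Suc k * x ^ k * (a * x)"
    using mult_eq_powers_mult[OF x(1,2), of k] y(3) by metis
  also have "\<dots> = y * a * (a ^ k * x ^ k * (a * x))"
    by (simp only: power_Suc mult.assoc)
  also have "\<dots> = y * a * (a * x)"
    using mult_eq_powers_mult[OF x(1,2), of k] by metis
  finally have "a * x * x = y * a * (a * x * x)"
    by (metis mult.assoc)
  then have 1: "x = y * a * x"
    using x(1,2) by metis
  have x3: "a ^ Suc k * x = a ^ k"
    using x(2,3) by (metis power_commuting_commutes)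
  have comm: "a ^ k * y ^ k = y ^ k * a ^ k" "y ^ k * a = a * y ^ k" "y ^ k * y = y * y ^ k"
    using y(2) by (metis power_commuting_commutes power_commutes)+
  have ay: "a * y = a * y * y ^ k * a ^ k"
  proof -
    have "a ^ k * (a * y) = a * y * a ^ k"
      using y(2) by (metis power_commuting_commutes power_commutes mult.assoc)
    moreover have "y ^ k * (a * y) = a * y * y ^ k"
      using comm by (metis mult.assoc)
    ultimately show ?thesis
      using mult_eq_powers_mult[OF y(1,2), of k] comm(1) by (metis mult.assoc)
  qed
  have "a * y = a * y * y ^ k * (a ^ Suc k * x)"
    using ay x3 by metis
  also have "\<dots> = a * y * y ^ k * a ^ k * (a * x)"
    by (simp only: power_Suc2 mult.assoc)
  also have "\<dots> = a * y * (a * x)"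
    using ay by metis
  finally have "y * a * y = y * a * y * a * x"
    by (metis mult.assoc)
  then have 2: "y = y * a * x"
    using y(1) by metis
  from 1 2 show ?thesis by metis
qed

section \<open>Powers of a matrix\<close>

lemma span_columns_eq_range:
  fixes A :: "'a::field^'n^'m"
  shows "vec.span (columns A) = range ((*v) A)"
proof (rule antisym)
  have "column j A = A *v axis j 1" for j
    by (simp add: vec_eq_iff column_def matrix_vector_mult_def axis_def if_distrib cong: if_cong)
  then have "columns A \<subseteq> range ((*v) A)"
    by (auto simp: columns_def)
  moreover have "vec.subspace (range ((*v) A))"
    by (rule vec.subspace_image) simp
  ultimately show "vec.span (columns A) \<subseteq> range ((*v) A)"
    by (rule vec.span_minimal)
  show "range ((*v) A) \<subseteq> vec.span (columns A)"
    using matrix_vector_mult_in_columnspace_gen by blast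
qed

text \<open>
  The rank is defined as the dimension of the row space; writing that space as the range of a
  linear map turns statements about ranks into inclusions of ranges.
\<close>
lemma rank_eq_dim_range_transpose:
  fixes A :: "'a::field^'n^'m"
  shows "rank A = vec.dim (range ((*v) (transpose A)))"
  unfolding row_rank_def_gen
  by (metis columns_transpose span_columns_eq_range vec.dim_span)

lemma matrix_right_factor:
  fixes P :: "'a::field^'n^'m" and Q :: "'a^'l^'m"
  assumes "range ((*v) P) \<subseteq> range ((*v) Q)"
  obtains Y where "P = Q ** Y"
proof -
  have "\<exists>y. P *v axis j 1 = Q *v y" for j
    using assms by blast
  then obtain y where y: "\<And>j. P *v axis j 1 = Q *v y j"
    by metis
  have "P = Q ** (\<chi> i j. y j $ i)"
  proof -
    have "P $ i $ j = (Q ** (\<chi> i j. y j $ i)) $ i $ j" for i j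
    proof -
      have "P $ i $ j = (P *v axis j 1) $ i"
        by (simp add: matrix_vector_mult_def axis_def if_distrib cong: if_cong)
      also have "\<dots> = (Q *v y j) $ i"
        by (simp only: y)
      also have "\<dots> = (Q ** (\<chi> i j. y j $ i)) $ i $ j"
        by (simp add: matrix_vector_mult_def matrix_matrix_mult_def)
      finally show ?thesis .
    qed
    then show ?thesis by (simp add: vec_eq_iff)
  qed
  then show ?thesis by (rule that)
qed

lemma range_transpose_mult_subset:
  fixes P :: "'a::field^'n^'m" and Q :: "'a^'m^'l"
  shows "range ((*v) (transpose (Q ** P))) \<subseteq> range ((*v) (transpose P))"
  by (auto simp: matrix_transpose_mul simp flip: matrix_vector_mul_assoc)

lemma rank_mult_le_right_factor:
  fixes P :: "'a::field^'n^'m" and Q :: "'a^'m^'l"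
  shows "rank (Q ** P) \<le> rank P"
  unfolding rank_eq_dim_range_transpose
  by (rule vec.dim_subset[OF range_transpose_mult_subset])

text \<open>
  The row space of \<open>Q P\<close> lies in that of \<open>P\<close>. If the dimensions agree, the spaces do, and every
  row of \<open>P\<close> is a combination of rows of \<open>Q P\<close>.
\<close>
lemma matrix_left_factor_of_rank_eq:
  fixes P :: "'a::field^'n^'m" and Q :: "'a^'m^'l"
  assumes "rank (Q ** P) = rank P"
  obtains Z where "P = Z ** (Q ** P)"
proof -
  have "range ((*v) (transpose (Q ** P))) = range ((*v) (transpose P))"
    using assms unfolding rank_eq_dim_range_transpose
    by (intro vec.subspace_dim_equal range_transpose_mult_subset vec.subspace_image) auto
  then obtain Y where "transpose P = transpose (Q ** P) ** Y"
    using matrix_right_factor by (metis subset_refl)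
  then have "P = transpose Y ** (Q ** P)"
    by (metis matrix_transpose_mul transpose_transpose)
  then show ?thesis by (rule that)
qed

lemma monoid_mult_matrix: "class.monoid_mult (mat 1 :: complex^'m^'m) (**)"
  by unfold_locales (simp_all add: matrix_mul_assoc)

lemma matrix_power_eq_power: "matrix_power A n = power.power (mat 1) (**) A n"
  by (induction n) (simp_all add: power.power.simps)

text \<open>
  The ranks of the powers are a decreasing sequence of naturals, so two consecutive ones agree and
  the least such exponent is attained.
\<close>
lemma rank_matrix_power_index:
  "rank (matrix_power A (matrix_index A)) = rank (matrix_power A (Suc (matrix_index A)))"
proof -
  let ?r = "\<lambda>n. rank (matrix_power A n)"
  have "\<exists>k. ?r k = ?r (Suc k)"
  proof (rule ccontr)
    assume "\<nexists>k. ?r k = ?r (Suc k)"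
    moreover have "?r (Suc k) \<le> ?r k" for k
      by (simp add: rank_mult_le_right_factor)
    ultimately have less: "?r (Suc k) < ?r k" for k
      by (metis le_neq_implies_less)
    have "?r k + k \<le> ?r 0" for k
    proof (induction k)
      case (Suc k)
      then show ?case using less[of k] by linarith
    qed simp
    from this[of "Suc (?r 0)"] show False by linarith
  qed
  then show ?thesis
    unfolding matrix_index_def by (rule LeastI_ex)
qed

text \<open>
  The two halves are reached differently: the row spaces give the left factor, by which \<open>A\<close> is
  injective on the range \<open>V\<close> of the power at the index. Since \<open>A\<close> maps the finite-dimensional space
  \<open>V\<close> into itself, it maps it onto itself, and this is a statement about column spaces that gives
  the right factor. Both factorisations persist at all higher exponents, so they hold at a \<open>k\<close>
  that exceeds the index.
\<close>
lemma matrix_power_stable_factors: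
  fixes A :: "complex^'m^'m"
  assumes k: "matrix_index A \<le> k"
  shows "\<exists>Z. matrix_power A k = Z ** matrix_power A (Suc k)"
    and "\<exists>Y. matrix_power A k = matrix_power A (Suc k) ** Y"
proof -
  interpret mm: monoid_mult "mat 1 :: complex^'m^'m" "(**)"
    by (rule monoid_mult_matrix)
  define P where "P = matrix_power A (matrix_index A)"
  have rank: "rank (A ** P) = rank P"
    using rank_matrix_power_index[of A] by (simp add: P_def)
  obtain Z where Z: "P = Z ** (A ** P)"
    using matrix_left_factor_of_rank_eq[OF rank] .
  have AP: "A ** P = P ** A"
    unfolding P_def matrix_power_eq_power by (simp add: mm.power_commutes)
  let ?V = "range ((*v) P)"
  have sub: "vec.subspace ?V"
    by (rule vec.subspace_image) simp
  have inj: "inj_on ((*v) A) ?V"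
  proof (rule inj_on_inverseI)
    show "Z *v (A *v u) = u" if "u \<in> ?V" for u
      using that Z by (auto simp: matrix_vector_mul_assoc) (metis matrix_mul_assoc)
  qed
  have "(*v) A ` ?V \<subseteq> ?V"
    using AP by (auto simp: matrix_vector_mul_assoc) (metis matrix_vector_mul_assoc rangeI)
  moreover have "vec.dim ((*v) A ` ?V) = vec.dim ?V"
    by (rule vec.dim_image_eq) (use inj sub in \<open>simp_all add: vec.span_eq_iff[THEN iffD2]\<close>)
  moreover have "vec.subspace ((*v) A ` ?V)"
    by (rule vec.subspace_image[OF sub])
  ultimately have "(*v) A ` ?V = ?V"
    using sub by (intro vec.subspace_dim_equal) auto
  moreover have "(*v) A ` ?V = range ((*v) (A ** P))"
    by (auto simp: image_iff matrix_vector_mul_assoc)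
  ultimately obtain Y where Y: "P = (A ** P) ** Y"
    using matrix_right_factor by (metis subset_refl)
  show "\<exists>Z. matrix_power A k = Z ** matrix_power A (Suc k)"
    using mm.power_eq_mult_power_Suc_mono[OF _ k, of A Z] Z
    unfolding P_def matrix_power_eq_power by (auto simp: mm.power_Suc)
  show "\<exists>Y. matrix_power A k = matrix_power A (Suc k) ** Y"
    using mm.power_eq_power_Suc_mult_mono[OF _ k, of A Y] Y
    unfolding P_def matrix_power_eq_power by (auto simp: mm.power_Suc)
qed

section \<open>The monoid of square tensors\<close>

lemma tensor_eqI:
  assumes "invertible M" and "\<And>i. tslice M C i = tslice M D i"
  shows "C = D"
  using ex1_tslice[OF assms(1), of "tslice M D"] assms(2) by blast

lemma mprod_assoc:
  assumes "invertible M"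
  shows "mprod M (mprod M A B) C = mprod M A (mprod M B C)"
  by (rule tensor_eqI[OF assms]) (simp add: tslice_mprod[OF assms] matrix_mul_assoc)

lemma monoid_mult_mprod:
  fixes M :: "complex^'p^'p"
  assumes "invertible M"
  shows "class.monoid_mult (mident M :: complex^'p^'m^'m) (mprod M)"
proof
  show "mprod M (mprod M A B) C = mprod M A (mprod M B C)" for A B C :: "complex^'p^'m^'m"
    by (rule mprod_assoc[OF assms])
  show "mprod M (mident M) A = A" "mprod M A (mident M) = A" for A :: "complex^'p^'m^'m"
    by (rule tensor_eqI[OF assms]; simp add: tslice_mprod[OF assms] tslice_mident[OF assms])+
qed

lemma mpow_eq_power: "mpow M A n = power.power (mident M) (mprod M) A n"
  by (induction n) (simp_all add: power.power.simps)

lemma tslice_mpow: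
  assumes "invertible M"
  shows "tslice M (mpow M A n) i = matrix_power (tslice M A i) n"
  by (induction n) (simp_all add: tslice_mprod[OF assms] tslice_mident[OF assms])

text \<open>
  The tubal index is at least the index of each slice, so both factorisations hold on all slices
  with the same exponent, and the factors assemble to tensors.
\<close>
lemma mpow_tubal_index_factors:
  fixes A :: "complex^'p^'m^'m"
  assumes M: "invertible M"
  defines "k \<equiv> tubal_index M A"
  obtains Z Y where "mpow M A k = mprod M Z (mpow M A (Suc k))"
    and "mpow M A k = mprod M (mpow M A (Suc k)) Y"
proof -
  let ?P = "\<lambda>i. matrix_power (tslice M A i)"
  have index: "matrix_index (tslice M A i) \<le> k" for i
    unfolding k_def tubal_index_def by simp
  have "\<forall>i. \<exists>Z. ?P i k = Z ** ?P i (Suc k)"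
    by (intro allI matrix_power_stable_factors(1) index)
  then obtain z where z: "\<forall>i. ?P i k = z i ** ?P i (Suc k)"
    by (rule choice[THEN exE])
  have "\<forall>i. \<exists>Y. ?P i k = ?P i (Suc k) ** Y"
    by (intro allI matrix_power_stable_factors(2) index)
  then obtain y where y: "\<forall>i. ?P i k = ?P i (Suc k) ** y i"
    by (rule choice[THEN exE])
  obtain Z where Z: "\<forall>i. tslice M Z i = z i"
    using ex1_tslice[OF M, of z] by blast
  obtain Y where Y: "\<forall>i. tslice M Y i = y i"
    using ex1_tslice[OF M, of y] by blast
  have "mpow M A k = mprod M Z (mpow M A (Suc k))"
  proof (rule tensor_eqI[OF M])
    show "tslice M (mpow M A k) i = tslice M (mprod M Z (mpow M A (Suc k))) i" for i
      using z Z by (simp only: tslice_mprod[OF M] tslice_mpow[OF M])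
  qed
  moreover have "mpow M A k = mprod M (mpow M A (Suc k)) Y"
  proof (rule tensor_eqI[OF M])
    show "tslice M (mpow M A k) i = tslice M (mprod M (mpow M A (Suc k)) Y) i" for i
      using y Y by (simp only: tslice_mprod[OF M] tslice_mpow[OF M])
  qed
  ultimately show ?thesis by (rule that)
qed

lemma drazin_equations:
  fixes A :: "complex^'p^'m^'m"
  assumes M: "invertible M"
  defines "X \<equiv> drazin M A" and "k \<equiv> tubal_index M A"
  shows "mprod M (mprod M X A) X = X"
    and "mprod M A X = mprod M X A"
    and "mprod M X (mpow M A (Suc k)) = mpow M A k"
proof -
  interpret T: monoid_mult "mident M :: complex^'p^'m^'m" "mprod M"
    by (rule monoid_mult_mprod[OF M])
  let ?D = "\<lambda>X. mprod M (mprod M X A) X = X \<and> mprod M A X = mprod M X A \<and>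
    mprod M X (mpow M A (Suc k)) = mpow M A k"
  obtain Z Y where "mpow M A k = mprod M Z (mpow M A (Suc k))"
    and "mpow M A k = mprod M (mpow M A (Suc k)) Y"
    using mpow_tubal_index_factors[OF M] unfolding k_def by blast
  then have "\<exists>X. ?D X"
    unfolding mpow_eq_power by (rule T.drazin_exists)
  moreover have "X = Y" if "?D X" "?D Y" for X Y
    using that T.drazin_unique[of X A k Y] unfolding mpow_eq_power by blast
  ultimately have "\<exists>!X. ?D X" by blast
  then have "?D X"
    unfolding X_def drazin_def k_def by (rule theI')
  then show "mprod M (mprod M X A) X = X" "mprod M A X = mprod M X A"
    "mprod M X (mpow M A (Suc k)) = mpow M A k"
    by blast+
qed

theorem proposition6p1:
  fixes M :: "complex^'p^'p" and A :: "complex^'p^'m^'m" and B :: "complex^'p^1^'m" and k :: nat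
  assumes "invertible M"
    and "tubal_index M A = k"
  shows "mprod M A (mprod M (drazin M A) B) = B \<longleftrightarrow> B \<in> mrange M (mpow M A k)"
proof -
  interpret T: monoid_mult "mident M :: complex^'p^'m^'m" "mprod M"
    by (rule monoid_mult_mprod[OF assms(1)])
  note assoc = mprod_assoc[OF assms(1)]
  define X where "X = drazin M A"
  note X = drazin_equations[OF assms(1), of A, folded X_def, unfolded assms(2)]
  show ?thesis
    unfolding X_def[symmetric]
  proof
    assume "mprod M A (mprod M X B) = B"
    moreover have "mprod M A X = mprod M (mprod M (mpow M A k) (mpow M X k)) (mprod M A X)"
      using T.mult_eq_powers_mult[OF X(1,2)] unfolding mpow_eq_power .
    ultimately have "B = mprod M (mpow M A k) (mprod M (mpow M X k) B)"
      by (metis assoc)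
    then show "B \<in> mrange M (mpow M A k)"
      unfolding mrange_def by blast
  next
    assume "B \<in> mrange M (mpow M A k)"
    then obtain Z :: "complex^'p^1^'m" where Z: "B = mprod M (mpow M A k) Z"
      unfolding mrange_def by blast
    have "mprod M (mprod M A X) (mpow M A k) = mpow M A k"
      using X(2,3) by (simp add: assoc)
    then show "mprod M A (mprod M X B) = B"
      unfolding Z by (metis assoc)
  qed
qed

end
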